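(* Let $b_n$, $n\ge 0$, be the Bernoulli numbers of the second kind, defined by the power series expansion $\frac{x}{\ln(1+x)}=\sum_{n=0}^\infty b_n x^n$ about $x=0$. Then for every positive integer $n$, $$b_n=(-1)^{n+1}\int_1^\infty\frac{1}{\{[\ln(t-1)]^2+\pi^2\}\,t^{n}}\,dt.$$
   Context: The function $x/\ln(1+x)$ is extended to $x=0$ by the value $1$; the $b_n$ are its Taylor coefficients at $0$, so $b_0=1$, $b_1=\frac12$, $b_2=-\frac1{12}$, $b_3=\frac1{24}$, etc. *)

theory Defs
  imports "HOL-Analysis.Analysis"
begin

definition x_over_ln :: "real \<Rightarrow> real" where
  "x_over_ln x = (if x = 0 then 1 else x / ln (1 + x))"

definition bernoulli2 :: "nat \<Rightarrow> real" where
  "bernoulli2 n = fps_nth (THE F. x_over_ln has_fps_expansion F) n"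

text \<open>
  The definite description is justified here: a power series expansion of the function about
  \<open>0\<close> exists and is unique.
\<close>

lemma has_fps_expansion_unique_real:
  fixes f :: "real \<Rightarrow> real"
  assumes "f has_fps_expansion F" "f has_fps_expansion G"
  shows   "F = G"
proof (rule ccontr)
  assume "F \<noteq> G"
  define H where "H = F - G"
  have H0: "H \<noteq> 0" using \<open>F \<noteq> G\<close> by (simp add: H_def)
  define n where "n = subdegree H"
  define h where "h = (\<lambda>x::real. if x = 0 then fps_nth H n else 0 / x ^ n)"
  have "(\<lambda>x. f x - f x) has_fps_expansion H"
    unfolding H_def by (intro has_fps_expansion_diff assms)
  hence "(\<lambda>x. 0) has_fps_expansion H" by simp
  hence "h has_fps_expansion fps_shift n H"
    unfolding h_def n_def by (rule has_fps_expansion_shift) auto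
  hence "isCont h 0"
    using has_fps_expansion_imp_continuous[of h _ UNIV] by simp
  hence "(h \<longlongrightarrow> fps_nth H n) (at 0)" by (simp add: isCont_def h_def)
  moreover have "\<forall>\<^sub>F x in at 0. h x = 0"
    by (auto simp: h_def eventually_at_filter)
  hence "(h \<longlongrightarrow> 0) (at 0)" by (rule tendsto_eventually)
  ultimately have "fps_nth H n = 0"
    using tendsto_unique[of "at (0::real)"] by auto
  with H0 show False by (simp add: n_def)
qed

lemma has_fps_expansion_ln_real: "(\<lambda>x::real. ln (1 + x)) has_fps_expansion fps_ln 1"
  unfolding has_fps_expansion_def
proof
  show "fps_conv_radius (fps_ln (1::real)) > 0"
    by (subst fps_conv_radius_ln_nonzero) auto
  have "\<forall>\<^sub>F x in nhds (0::real). x \<in> {-1<..<1}"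
    by (intro eventually_nhds_in_open) auto
  thus "\<forall>\<^sub>F x in nhds 0. eval_fps (fps_ln 1) x = ln (1 + x :: real)"
  proof eventually_elim
    case (elim x)
    hence "ln (1 + x) = (\<Sum>n. (-1) ^ n * (1 / real (n + 1)) * (1 + x - 1) ^ Suc n)"
      by (intro ln_series) auto
    moreover have "summable (\<lambda>n. fps_nth (fps_ln 1) n * x ^ n)"
      by (rule summable_fps, subst fps_conv_radius_ln_nonzero) (use elim in auto)
    hence "(\<Sum>n. fps_nth (fps_ln 1) (Suc n) * x ^ Suc n) = eval_fps (fps_ln 1) x"
      by (subst suminf_split_head) (auto simp: eval_fps_def)
    ultimately show ?case by (simp add: fps_ln_nth)
  qed
qed

lemma x_over_ln_has_fps_expansion_ex1: "\<exists>!F. x_over_ln has_fps_expansion F"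
proof -
  have nz: "fps_nth (fps_ln (1::real)) 1 = 1" by (simp add: fps_ln_nth)
  hence ne: "fps_ln (1::real) \<noteq> 0" by auto
  have sd: "subdegree (fps_ln (1::real)) = 1"
    by (rule subdegreeI) (auto simp: fps_ln_nth)
  have "(\<lambda>x::real. if x = 0 then 1 else x / ln (1 + x)) has_fps_expansion (fps_X / fps_ln 1)"
    by (rule has_fps_expansion_divide[OF has_fps_expansion_fps_X has_fps_expansion_ln_real])
       (use ne sd nz in auto)
  moreover have "x_over_ln = (\<lambda>x. if x = 0 then 1 else x / ln (1 + x))"
    by (simp add: fun_eq_iff x_over_ln_def)
  ultimately show ?thesis using has_fps_expansion_unique_real by metis
qed

lemma x_over_ln_has_fps_expansion: "x_over_ln has_fps_expansion Abs_fps bernoulli2"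
proof -
  have "Abs_fps bernoulli2 = (THE F. x_over_ln has_fps_expansion F)"
    by (simp add: fps_eq_iff bernoulli2_def)
  thus ?thesis using theI'[OF x_over_ln_has_fps_expansion_ex1] by simp
qed

lemma bernoulli2_sums: "\<forall>\<^sub>F x in nhds 0. (\<lambda>n. bernoulli2 n * x ^ n) sums x_over_ln x"
proof -
  let ?F = "Abs_fps bernoulli2"
  have r: "fps_conv_radius ?F > 0" and e: "\<forall>\<^sub>F x in nhds 0. eval_fps ?F x = x_over_ln x"
    using x_over_ln_has_fps_expansion by (auto simp: has_fps_expansion_def)
  have "\<forall>\<^sub>F x in nhds 0. x \<in> eball 0 (fps_conv_radius ?F)"
    using r by (intro eventually_nhds_in_open) (auto simp: zero_ereal_def)
  with e show ?thesis
    by eventually_elim (use sums_eval_fps[of _ ?F] in \<open>fastforce simp: in_eball_iff\<close>)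
qed

end

theory Submission
  imports Defs
begin

text \<open>
  Integrating \<open>(1 + z)\<^sup>x = (\<Sum>n. (x gchoose n) z\<^sup>n)\<close> over \<open>0 \<le> x \<le> 1\<close> shows that
  \<open>b\<^sub>n\<close> is the integral of \<open>x gchoose n\<close> over the unit interval. The reflection formula turns
  the binomial coefficient into \<open>(-1)\<^sup>n\<^sup>+\<^sup>1 (sin (\<pi>x) / \<pi>) B(n - x, x + 1)\<close>, and the
  substitution \<open>v = 1/t\<close> in Euler's integral writes the Beta value as the integral of
  \<open>(t - 1)\<^sup>x / t\<^sup>n\<^sup>+\<^sup>1\<close> over \<open>t > 1\<close>. By Tonelli's theorem the two integrals can be
  exchanged, and the inner one is elementary.
\<close>

section \<open>Coefficients as integrals of generalized binomial coefficients\<close>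

text \<open>Each factor \<open>(x - n) / (n + 1)\<close> of the recursion has absolute value at most
  1 on the unit interval. The bound is uniform in \<open>x\<close> and \<open>n\<close>, so a
  geometric series dominates the binomial series.\<close>

lemma abs_gbinomial_le_1:
  fixes x :: real
  assumes "0 \<le> x" "x \<le> 1"
  shows "\<bar>x gchoose n\<bar> \<le> 1"
proof (induction n)
  case (Suc n)
  have "\<bar>x - n\<bar> / (n + 1) \<le> 1"
    using assms by (auto simp: field_simps)
  hence "\<bar>x gchoose n\<bar> * (\<bar>x - n\<bar> / (n + 1)) \<le> 1 * 1"
    using Suc by (intro mult_mono) auto
  thus ?case
    by (simp add: gbinomial_Suc_rec abs_mult flip: of_nat_Suc)
qed auto

lemma gbinomial_measurable [measurable]: "(\<lambda>x::real. x gchoose n) \<in> borel_measurable borel"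
  unfolding gbinomial_prod_rev by measurable

lemma set_integrable_gbinomial: "set_integrable lborel {0..1} (\<lambda>x::real. x gchoose n)"
  unfolding gbinomial_prod_rev
  by (intro borel_integrable_atLeastAtMost' continuous_intros) auto

lemma has_real_derivative_powr_exponent:
  fixes a :: real
  assumes "a > 0"
  shows "((\<lambda>x. a powr x) has_real_derivative a powr x * ln a) (at x within S)"
proof -
  have "(\<lambda>x. a powr x) = (\<lambda>x. exp (x * ln a))"
    using assms by (simp add: powr_def fun_eq_iff)
  thus ?thesis
    using assms by (auto simp: powr_def intro!: derivative_eq_intros)
qed

text \<open>Used at \<open>y = 1 + z\<close>, where the value becomes \<open>x_over_ln z\<close>;
  the case \<open>y = 1\<close> matches the value at the removable singularity.\<close>

lemma set_integral_powr_unit: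
  fixes y :: real
  assumes "y > 0"
  shows "(LBINT x:{0..1}. y powr x) = (if y = 1 then 1 else (y - 1) / ln y)"
proof (cases "y = 1")
  case True
  thus ?thesis by (simp add: set_lebesgue_integral_def)
next
  case False
  hence ln: "ln y \<noteq> 0" using assms by simp
  have deriv: "((\<lambda>x. y powr x / ln y) has_vector_derivative y powr x) (at x within {0..1})" for x
    using DERIV_cdivide[OF has_real_derivative_powr_exponent[OF assms], of "ln y"] ln
    by (simp add: has_real_derivative_iff_has_vector_derivative)
  have "(LBINT x:{0..1}. y powr x) = y powr 1 / ln y - y powr 0 / ln y"
    unfolding set_lebesgue_integral_def
    by (rule integral_FTC_Icc[OF _ deriv]) (use assms in \<open>auto intro!: continuous_intros\<close>)
  thus ?thesis using assms False by (simp add: diff_divide_distrib)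
qed

lemma bernoulli2_eq_integral_gbinomial:
  "bernoulli2 n = (LBINT x:{0..1}. x gchoose n)"
proof -
  define c where "c = (\<lambda>n. LBINT x:{0..1::real}. x gchoose n)"
  have "(\<lambda>n. c n * z ^ n) sums x_over_ln z" if z: "\<bar>z\<bar> < 1" for z
  proof -
    let ?f = "\<lambda>n x. indicator {0..1} x *\<^sub>R ((x gchoose n) * z ^ n)"
    have bound: "norm (?f n x) \<le> indicator {0..1} x *\<^sub>R (\<bar>z\<bar> ^ n)" for n x
      using mult_right_mono[OF abs_gbinomial_le_1[of x n], of "\<bar>z\<bar> ^ n"]
      by (auto simp: indicator_def abs_mult power_abs)
    have int: "integrable lborel (?f n)" for n
    proof -
      have "set_integrable lborel {0..1} (\<lambda>x. (x gchoose n) * z ^ n)"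
        by (intro set_integrable_mult_left set_integrable_gbinomial)
      thus ?thesis by (simp add: set_integrable_def)
    qed
    have geo: "summable (\<lambda>n. \<bar>z\<bar> ^ n)"
      using z by (intro summable_geometric) auto
    \<comment> \<open>Sum and integral commute: the terms are dominated by
      \<open>\<bar>z\<bar> ^ n\<close>, both pointwise and after integration of their norms.\<close>
    have "(\<lambda>n. integral\<^sup>L lborel (?f n)) sums (\<integral>x. (\<Sum>n. ?f n x) \<partial>lborel)"
    proof (rule sums_integral[OF int])
      show "AE x in lborel. summable (\<lambda>n. norm (?f n x))"
      proof (intro AE_I2)
        fix x :: real
        show "summable (\<lambda>n. norm (?f n x))"
          by (rule summable_comparison_test'[OF summable_mult[OF geo, of "indicator {0..1} x"]])
             (use bound in \<open>auto simp del: norm_scaleR\<close>)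
      qed
      have "norm (\<integral>x. norm (?f n x) \<partial>lborel) \<le> \<bar>z\<bar> ^ n" for n
      proof -
        have "(\<integral>x. norm (?f n x) \<partial>lborel) \<le> (\<integral>x. indicator {0..1::real} x *\<^sub>R (\<bar>z\<bar> ^ n) \<partial>lborel)"
          by (intro integral_mono integrable_norm int bound) auto
        also have "\<dots> = \<bar>z\<bar> ^ n" by simp
        finally show ?thesis by simp
      qed
      thus "summable (\<lambda>n. \<integral>x. norm (?f n x) \<partial>lborel)"
        by (intro summable_comparison_test'[OF geo]) auto
    qed
    moreover have "integral\<^sup>L lborel (?f n) = c n * z ^ n" for n
      unfolding c_def set_lebesgue_integral_def by (simp flip: mult.assoc)
    moreover have "(\<Sum>n. ?f n x) = indicator {0..1} x *\<^sub>R ((1 + z) powr x)" for x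
      using gen_binomial_real[OF z, of x] by (auto simp: indicator_def sums_iff)
    moreover have "(\<integral>x. indicator {0..1} x *\<^sub>R ((1 + z) powr x) \<partial>lborel) = x_over_ln z"
      using set_integral_powr_unit[of "1 + z"] z
      by (auto simp: set_lebesgue_integral_def x_over_ln_def)
    ultimately show ?thesis by simp
  qed
  moreover have "\<forall>\<^sub>F z in nhds (0::real). z \<in> {-1<..<1}"
    by (intro eventually_nhds_in_open) auto
  \<comment> \<open>The series represents \<open>x_over_ln\<close> on a neighbourhood of 0, so
    uniqueness of power series expansions identifies the coefficients.\<close>
  ultimately have "x_over_ln has_fps_expansion Abs_fps c"
    by (intro has_fps_expansionI) (auto elim!: eventually_mono)
  hence "Abs_fps bernoulli2 = Abs_fps c"
    using has_fps_expansion_unique_real x_over_ln_has_fps_expansion by blast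
  hence "bernoulli2 n = c n" by (metis fps_nth_Abs_fps)
  thus ?thesis by (simp add: c_def)
qed

section \<open>Reflection formula and Euler's Beta integral\<close>

text \<open>Inherited from the complex formula. At integers both sides are 0, because
  \<open>Gamma\<close> at its poles and division by zero have the value 0.\<close>

lemma Gamma_reflection_real: "Gamma x * Gamma (1 - x) = pi / sin (pi * x)" for x :: real
proof -
  have "complex_of_real (Gamma x * Gamma (1 - x)) =
          Gamma (of_real x) * Gamma (1 - of_real x)"
    using Gamma_complex_of_real[of "1 - x"] by (simp add: Gamma_complex_of_real)
  also have "\<dots> = of_real (pi / sin (pi * x))"
    by (simp add: Gamma_reflection_complex flip: sin_of_real)
  finally show ?thesis by (simp only: of_real_eq_iff)
qed

text \<open>Induction: the base case is the reflection formula, and in the step both sides acquire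
  the factor \<open>(x - Suc n) / (Suc n + 1)\<close>. Starting at index 1 keeps both Beta arguments
  positive.\<close>

lemma gbinomial_eq_sin_Beta:
  fixes x :: real
  assumes "0 < x" "x < 1"
  shows "x gchoose Suc n = (-1) ^ n * (sin (pi * x) / pi) * Beta (Suc n - x) (x + 1)"
proof (induction n)
  case 0
  have "Gamma (x + 1) = x * Gamma x"
    using assms by (intro Gamma_plus1) (auto dest: nonpos_Ints_nonpos)
  moreover have "sin (pi * x) \<noteq> 0"
    using sin_gt_zero[of "pi * x"] assms by auto
  ultimately show ?case
    using Gamma_reflection_real[of x]
    by (simp add: Beta_def Gamma_numeral field_simps)
next
  case (Suc n)
  \<comment> \<open>The two Beta arguments add up to \<open>Suc n + 1\<close>, so \<open>x\<close>
    cancels from the left-hand factor.\<close>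
  have "(Suc n + 1) * Beta (Suc n - x + 1) (x + 1) = (Suc n - x) * Beta (Suc n - x) (x + 1)"
    using Beta_plus1_left[of "Suc n - x" "x + 1"] assms
    by (force dest: nonpos_Ints_nonpos simp: algebra_simps)
  hence B: "Beta (Suc (Suc n) - x) (x + 1) = (Suc n - x) / (Suc n + 1) * Beta (Suc n - x) (x + 1)"
    by (simp add: field_simps)
  have "x gchoose Suc (Suc n) = (x gchoose Suc n) * ((x - Suc n) / (Suc n + 1))"
    by (subst gbinomial_Suc_rec) (simp add: field_simps)
  also have "(x - Suc n) / (Suc n + 1) = - ((Suc n - x) / (Suc n + 1))"
    by (simp add: minus_divide_left)
  finally show ?case unfolding Suc.IH B by (simp only: power_Suc mult_ac mult_minus_left mult_minus_right mult_1)
qed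

text \<open>Euler's integral under \<open>v = inverse t\<close>, which maps the ray beyond 1 onto
  the open unit interval with Jacobian \<open>inverse t ^ 2\<close>.\<close>

lemma has_integral_Beta_shifted:
  fixes x :: real
  assumes "0 < x" "x < 1"
  shows "((\<lambda>t. (t - 1) powr x / t ^ Suc (Suc n)) has_integral Beta (Suc n - x) (x + 1)) {1<..}"
proof -
  let ?f = "\<lambda>v::real. v powr (Suc n - x - 1) * (1 - v) powr (x + 1 - 1)"
  have "(?f has_integral Beta (Suc n - x) (x + 1)) {0<..<1}"
    using has_integral_Beta_real[of "Suc n - x" "x + 1"] assms
    by (simp add: has_integral_Icc_iff_Ioo)
  \<comment> \<open>The change of variables needs absolute integrability, which follows from
    nonnegativity.\<close>
  hence "?f absolutely_integrable_on {0<..<1} \<and> integral {0<..<1} ?f = Beta (Suc n - x) (x + 1)"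
    by (subst absolutely_integrable_on_iff_nonneg) (auto simp: has_integral_iff)
  moreover have "inverse ` {1<..} = {0<..<1::real}"
  proof (intro equalityI subsetI)
    fix v :: real assume "v \<in> {0<..<1}"
    thus "v \<in> inverse ` {1<..}"
      by (intro image_eqI[of _ _ "inverse v"]) (auto simp: one_less_inverse_iff)
  qed (auto simp: inverse_less_1_iff)
  ultimately have "(\<lambda>t. \<bar>- (inverse t ^ 2)\<bar> * ?f (inverse t)) absolutely_integrable_on {1<..} \<and>
     integral {1<..} (\<lambda>t. \<bar>- (inverse t ^ 2)\<bar> * ?f (inverse t)) = Beta (Suc n - x) (x + 1)"
    by (subst has_absolute_integral_change_of_variables_1')
       (auto intro!: derivative_eq_intros inj_onI simp: power2_eq_square)
  hence "((\<lambda>t. \<bar>- (inverse t ^ 2)\<bar> * ?f (inverse t)) has_integral Beta (Suc n - x) (x + 1)) {1<..}"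
    using set_lebesgue_integral_eq_integral(1) by (auto simp: has_integral_iff)
  moreover have "\<bar>- (inverse t ^ 2)\<bar> * ?f (inverse t) = (t - 1) powr x / t ^ Suc (Suc n)"
    if "t \<in> {1<..}" for t
  proof -
    have t: "t > 1" using that by simp
    \<comment> \<open>Here \<open>1 - inverse t = (t - 1) / t\<close>; the resulting
      \<open>t powr x\<close> in the denominator cancels the \<open>x\<close> in the first
      exponent.\<close>
    have "?f (inverse t) = t powr (x - n) * ((t - 1) powr x / t powr x)"
      using t by (simp add: powr_divide[symmetric] diff_divide_distrib powr_minus[symmetric]
                    inverse_powr inverse_eq_divide[symmetric])
    also have "\<dots> = (t - 1) powr x / t ^ n"
      using t by (simp add: powr_diff powr_realpow)
    finally show ?thesis using t by (simp add: field_simps power2_eq_square)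
  qed
  ultimately show ?thesis
    by (subst has_integral_cong) (auto simp del: power_Suc)
qed

section \<open>The inner integral and Tonelli's theorem\<close>

text \<open>At \<open>u = t - 1\<close> the numerator \<open>1 + u\<close> is \<open>t\<close>,
  which lowers the power of \<open>t\<close> in the kernel from \<open>Suc n\<close> to
  \<open>n\<close>.\<close>

lemma nn_integral_sin_powr:
  fixes u :: real
  assumes "u > 0"
  shows "(\<integral>\<^sup>+x\<in>{0..1}. ennreal (sin (pi * x) / pi * u powr x) \<partial>lborel)
          = ennreal ((1 + u) / ((ln u)\<^sup>2 + pi\<^sup>2))"
proof -
  define D where "D = (ln u)\<^sup>2 + pi\<^sup>2"
  have D: "D > 0" unfolding D_def by (intro add_nonneg_pos) auto
  \<comment> \<open>The imaginary part of \<open>exp (a * x) / (pi * a)\<close> with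
    \<open>a = ln u + i * pi\<close>; \<open>D\<close> is the squared modulus of
    \<open>a\<close>.\<close>
  define F where "F = (\<lambda>x. u powr x * (ln u * sin (pi * x) - pi * cos (pi * x)) / (pi * D))"
  have "(\<integral>\<^sup>+x\<in>{0..1}. ennreal (sin (pi * x) / pi * u powr x) \<partial>lborel) = F 1 - F 0"
  proof (rule nn_integral_FTC_Icc)
    fix x :: real assume x: "x \<in> {0..1}"
    let ?w = "ln u * sin (pi * x) - pi * cos (pi * x)"
    have "(F has_real_derivative
            (u powr x * ln u * ?w + u powr x * (pi * ln u * cos (pi * x) + pi * pi * sin (pi * x)))
              / (pi * D)) (at x)"
      unfolding F_def
      by (rule DERIV_cdivide,
          rule DERIV_cong[OF DERIV_mult[OF has_real_derivative_powr_exponent[OF assms]]])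
         (auto intro!: derivative_eq_intros simp: algebra_simps)
    also have "(u powr x * ln u * ?w + u powr x * (pi * ln u * cos (pi * x) + pi * pi * sin (pi * x)))
                 = sin (pi * x) * u powr x * D"
      by (simp add: D_def power2_eq_square algebra_simps)
    also have "\<dots> / (pi * D) = sin (pi * x) / pi * u powr x"
      using D by simp
    finally show "(F has_real_derivative sin (pi * x) / pi * u powr x) (at x)" .
    show "0 \<le> sin (pi * x) / pi * u powr x"
      using x by (intro mult_nonneg_nonneg divide_nonneg_pos sin_ge_zero) auto
  qed auto
  \<comment> \<open>The sine vanishes at both ends and the cosine changes sign, so
    \<open>F 1 = u / D\<close> and \<open>F 0 = - 1 / D\<close>.\<close>
  also have "F 1 - F 0 = (1 + u) / D"
    using assms D by (simp add: F_def field_simps)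
  finally show ?thesis by (simp add: D_def)
qed

lemma nn_integral_gbinomial:
  assumes "n \<ge> 1"
  shows "(\<integral>\<^sup>+x\<in>{0<..<1}. ennreal ((-1) ^ (n + 1) * (x gchoose n)) \<partial>lborel) =
         (\<integral>\<^sup>+t\<in>{1<..}. ennreal (1 / (((ln (t - 1))\<^sup>2 + pi\<^sup>2) * t ^ n)) \<partial>lborel)"
proof -
  obtain m where n: "n = Suc m" using assms by (cases n) auto
  \<comment> \<open>Both domains enter as indicators, giving one nonnegative kernel on the plane for
    Tonelli's theorem.\<close>
  let ?K = "\<lambda>x t. ennreal (sin (pi * x) / pi * (t - 1) powr x / t ^ Suc n)
                    * indicator {1<..} t * indicator {0<..<1} x"
  have sin: "sin (pi * x) / pi \<ge> 0" if "0 < x" "x < 1" for x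
    using that by (intro divide_nonneg_pos sin_ge_zero) auto
  have "(\<integral>\<^sup>+x\<in>{0<..<1}. ennreal ((-1) ^ (n + 1) * (x gchoose n)) \<partial>lborel) =
        (\<integral>\<^sup>+x. (\<integral>\<^sup>+t. ?K x t \<partial>lborel) \<partial>lborel)"
  proof (intro nn_integral_cong)
    fix x :: real
    show "ennreal ((-1) ^ (n + 1) * (x gchoose n)) * indicator {0<..<1} x = (\<integral>\<^sup>+t. ?K x t \<partial>lborel)"
    proof (cases "x \<in> {0<..<1}")
      case True
      hence x: "0 < x" "x < 1" by auto
      have "ennreal (Beta (n - x) (x + 1)) =
              (\<integral>\<^sup>+t. ennreal (indicator {1<..} t * ((t - 1) powr x / t ^ Suc n)) \<partial>lborel)"
        using nn_integral_has_integral_lebesgue[OF _ has_integral_Beta_shifted[OF x, of m]]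
        by (simp add: n)
      hence "ennreal (sin (pi * x) / pi) * ennreal (Beta (n - x) (x + 1)) =
              (\<integral>\<^sup>+t. ennreal (sin (pi * x) / pi) *
                  ennreal (indicator {1<..} t * ((t - 1) powr x / t ^ Suc n)) \<partial>lborel)"
        by (simp add: nn_integral_cmult)
      also have "\<dots> = (\<integral>\<^sup>+t. ?K x t \<partial>lborel)"
        using x sin[OF x]
        by (intro nn_integral_cong) (auto simp: indicator_def ennreal_mult'[symmetric])
      \<comment> \<open>The signs \<open>(-1) ^ (n + 1)\<close> and \<open>(-1) ^ m\<close> cancel,
        since \<open>n + 1 = m + 2\<close>.\<close>
      also have "ennreal (sin (pi * x) / pi) * ennreal (Beta (n - x) (x + 1)) =
                  ennreal ((-1) ^ (n + 1) * (x gchoose n))"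
        unfolding n gbinomial_eq_sin_Beta[OF x] using sin[OF x]
        by (simp add: ennreal_mult'[symmetric] flip: mult.assoc power_add)
      finally show ?thesis using True by simp
    qed auto
  qed
  also have "\<dots> = (\<integral>\<^sup>+t. (\<integral>\<^sup>+x. ?K x t \<partial>lborel) \<partial>lborel)"
    by (rule lborel_pair.Fubini') measurable
  also have "\<dots> = (\<integral>\<^sup>+t\<in>{1<..}. ennreal (1 / (((ln (t - 1))\<^sup>2 + pi\<^sup>2) * t ^ n)) \<partial>lborel)"
  proof (intro nn_integral_cong)
    fix t :: real
    show "(\<integral>\<^sup>+x. ?K x t \<partial>lborel) =
            ennreal (1 / (((ln (t - 1))\<^sup>2 + pi\<^sup>2) * t ^ n)) * indicator {1<..} t"
    proof (cases "t > 1")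
      case True
      have pos: "(ln (t - 1))\<^sup>2 + pi\<^sup>2 > 0" by (intro add_nonneg_pos) auto
      \<comment> \<open>Closing the interval leaves the integrand unchanged pointwise, as
        \<open>sin (pi * x)\<close> vanishes at 0 and 1.\<close>
      have "(\<integral>\<^sup>+x. ?K x t \<partial>lborel) =
             (\<integral>\<^sup>+x. ennreal (1 / t ^ Suc n) *
               (ennreal (sin (pi * x) / pi * (t - 1) powr x) * indicator {0..1} x) \<partial>lborel)"
        using True by (intro nn_integral_cong)
           (auto simp: indicator_def ennreal_mult'[symmetric] mult_ac)
      also have "\<dots> = ennreal (1 / t ^ Suc n) * ennreal (t / ((ln (t - 1))\<^sup>2 + pi\<^sup>2))"
        using nn_integral_sin_powr[of "t - 1"] True by (subst nn_integral_cmult) auto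
      also have "\<dots> = ennreal (1 / (((ln (t - 1))\<^sup>2 + pi\<^sup>2) * t ^ n))"
        using True pos by (subst ennreal_mult'[symmetric]) (auto simp: field_simps)
      finally show ?thesis using True by simp
    qed auto
  qed
  finally show ?thesis .
qed

section \<open>Integrability and return to Lebesgue integrals\<close>

theorem theorem4p1:
  fixes n :: nat
  assumes "n \<ge> 1"
  shows "set_integrable lborel {1<..} (\<lambda>t::real. 1 / (((ln (t - 1))\<^sup>2 + pi\<^sup>2) * t ^ n))
    \<and> bernoulli2 n = (-1) ^ (n + 1) *
        (LBINT t:{1<..}. 1 / (((ln (t - 1))\<^sup>2 + pi\<^sup>2) * t ^ n))"
proof -
  let ?f = "\<lambda>t::real. 1 / (((ln (t - 1))\<^sup>2 + pi\<^sup>2) * t ^ n)"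
  let ?g = "\<lambda>x::real. (-1) ^ (n + 1) * (x gchoose n)"
  \<comment> \<open>Nonnegativity of the signed coefficient allows its extended integral to be read
    as a real one.\<close>
  have g_nonneg: "?g x \<ge> 0" if "x \<in> {0<..<1}" for x
  proof -
    obtain m where n: "n = Suc m" using assms by (cases n) auto
    have "Beta (n - x) (x + 1) \<ge> 0" "sin (pi * x) \<ge> 0"
      using that by (auto simp: Beta_def n intro!: sin_ge_zero mult_nonneg_nonneg divide_nonneg_nonneg Gamma_real_nonneg)
    thus ?thesis
      using that unfolding n by (subst gbinomial_eq_sin_Beta) (auto simp flip: mult.assoc power_add)
  qed
  have g_int: "set_integrable lborel {0<..<1} ?g"
    by (intro set_integrable_mult_right set_integrable_subset[OF set_integrable_gbinomial]) auto
  have "(\<integral>\<^sup>+t. ennreal (indicator {1<..} t *\<^sub>R ?f t) \<partial>lborel)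
         = (\<integral>\<^sup>+t\<in>{1<..}. ennreal (?f t) \<partial>lborel)"
    by (intro nn_integral_cong) (auto simp: indicator_def)
  also have "\<dots> = (\<integral>\<^sup>+x\<in>{0<..<1}. ennreal (?g x) \<partial>lborel)"
    using nn_integral_gbinomial[OF assms] ..
  also have "\<dots> = (\<integral>\<^sup>+x. ennreal (indicator {0<..<1} x *\<^sub>R ?g x) \<partial>lborel)"
    by (intro nn_integral_cong) (auto simp: indicator_def)
  also have "\<dots> = ennreal (LBINT x:{0<..<1}. ?g x)"
    unfolding set_lebesgue_integral_def
    using g_int g_nonneg
    by (intro nn_integral_eq_integral) (auto simp: set_integrable_def indicator_def)
  finally have nn: "(\<integral>\<^sup>+t. ennreal (indicator {1<..} t *\<^sub>R ?f t) \<partial>lborel)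
                      = ennreal (LBINT x:{0<..<1}. ?g x)" .
  have f_nonneg: "AE t in lborel. 0 \<le> indicator {1<..} t *\<^sub>R ?f t"
    by (intro AE_I2) (auto simp: indicator_def)
  \<comment> \<open>The nonnegative integral of \<open>?f\<close> equals a real number by
    \<open>nn\<close>, hence is finite.\<close>
  have f_int: "set_integrable lborel {1<..} ?f"
    unfolding set_integrable_def
    by (rule integrableI_nn_integral_finite[OF _ f_nonneg nn]) measurable
  have "(LBINT t:{1<..}. ?f t) = (LBINT x:{0<..<1}. ?g x)"
  proof -
    have "(LBINT x:{0<..<1}. ?g x) \<ge> 0"
      unfolding set_lebesgue_integral_def
      using g_nonneg by (intro Bochner_Integration.integral_nonneg) (auto simp: indicator_def)
    moreover have "(\<lambda>t. indicator {1<..} t *\<^sub>R ?f t) \<in> borel_measurable lborel"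
      by measurable
    ultimately show ?thesis
      unfolding set_lebesgue_integral_def[of _ "{1<..}"]
      by (simp only: integral_eq_nn_integral[OF _ f_nonneg] nn enn2real_ennreal)
  qed
  also have "\<dots> = (-1) ^ (n + 1) * (LBINT x:{0<..<1}. x gchoose n)"
    by (rule set_integral_mult_right)
  also have "(LBINT x:{0<..<1}. x gchoose n) = (LBINT x:{0..1::real}. x gchoose n)"
  proof -
    have "AE x in lborel. x \<in> {0..1} \<longleftrightarrow> x \<in> {0<..<1::real}"
      using AE_lborel_singleton[of "0::real"] AE_lborel_singleton[of "1::real"]
      by eventually_elim auto
    thus ?thesis
      by (intro set_integral_cong_set) (simp_all add: set_borel_measurable_def)
  qed
  also have "\<dots> = bernoulli2 n"
    by (simp only: bernoulli2_eq_integral_gbinomial)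
  \<comment> \<open>The sign moves to the other side because its square is 1.\<close>
  finally show ?thesis using f_int by (auto simp flip: power_add mult.assoc)
qed

end
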